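(* Let $G=\{g_1,\ldots,g_n\}$ be a finite group and let $X, Y$ be two independent random variables with values in $G$. Then $$\mathrm{Con}(X\cdot Y)=\mathrm{Con}(X)\,\mathrm{Con}(Y),$$ where $X\cdot Y$ is the convolution of $X$ and $Y$ (the $G$-valued random variable given by the product of $X$ and $Y$ in $G$), $\mathrm{Con}$ denotes the convolution matrix, and the right-hand side is the matrix product.
   Context: Let $G=\{g_1,\ldots,g_n\}$ be a finite group with a fixed enumeration of its $n$ elements. For each $k\in\{1,\ldots,n\}$ let $\sigma_k$ be the permutation of $[n]=\{1,\ldots,n\}$ induced by left translation by $g_k$, i.e. $g_k g_j=g_{\sigma_k(j)}$ for all $j\in[n]$. Let $P_{\sigma_k}=(p^{(k)}_{ij})_{n\times n}$ be the permutation matrix with $p^{(k)}_{ij}=1$ if $i=\sigma_k(j)$ and $p^{(k)}_{ij}=0$ otherwise. For a $G$-valued random variable $X$ with $p_k=\mathbb{P}[X=g_k]$, $k=1,\ldots,n$, the convolution matrix of $X$ is the $n\times n$ matrix $$\mathrm{Con}(X)=\sum_{k=1}^n p_k P_{\sigma_k}.$$ *)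

theory Defs
  imports
    "HOL-Probability.Probability"
    "HOL-Algebra.Group"
    "Jordan_Normal_Form.Matrix"
begin

text \<open>The enumeration of the group is shifted to \<open>g 0, \<dots>, g (n - 1)\<close>, so that its indices
  coincide with the 0-based row and column indices of \<^typ>\<open>'a mat\<close>. It enters below as a function
  \<open>g\<close> with \<open>bij_betw g {..<n} (carrier G)\<close>.\<close>

text \<open>\<open>left_transl_perm G n g k j\<close> is the unique index \<open>i < n\<close> with \<open>g k \<otimes> g j = g i\<close>; it is
  meaningful only for \<open>k < n\<close> and \<open>j < n\<close>.\<close>

definition left_transl_perm :: "('a, 'c) monoid_scheme \<Rightarrow> nat \<Rightarrow> (nat \<Rightarrow> 'a) \<Rightarrow> nat \<Rightarrow> nat \<Rightarrow> nat" where
  "left_transl_perm G n g k j = the_inv_into {..<n} g (g k \<otimes>\<^bsub>G\<^esub> g j)"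

definition perm_matrix :: "nat \<Rightarrow> (nat \<Rightarrow> nat) \<Rightarrow> real mat" where
  "perm_matrix n \<sigma> = mat n n (\<lambda>(i, j). if i = \<sigma> j then 1 else 0)"

text \<open>The size of a \<^typ>\<open>real mat\<close> is not part of its type, so the sum of matrices is the \<open>finsum\<close>
  of the module of \<open>n \<times> n\<close> matrices.\<close>

definition conv_matrix ::
  "('a, 'c) monoid_scheme \<Rightarrow> nat \<Rightarrow> (nat \<Rightarrow> 'a) \<Rightarrow> 'w measure \<Rightarrow> ('w \<Rightarrow> 'a) \<Rightarrow> real mat" where
  "conv_matrix G n g M X =
     (\<Oplus>\<^bsub>module_mat TYPE(real) n n\<^esub>k\<in>{..<n}.
        \<P>(\<omega> in M. X \<omega> = g k) \<cdot>\<^sub>m perm_matrix n (left_transl_perm G n g k))"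

lemma left_transl_perm:
  assumes "group G" "bij_betw g {..<n} (carrier G)" "k < n" "j < n"
  shows "left_transl_perm G n g k j < n" "g (left_transl_perm G n g k j) = g k \<otimes>\<^bsub>G\<^esub> g j"
proof -
  have "g k \<otimes>\<^bsub>G\<^esub> g j \<in> carrier G"
    using assms by (intro monoid.m_closed group.is_monoid) (auto simp: bij_betw_def)
  then have *: "g k \<otimes>\<^bsub>G\<^esub> g j \<in> g ` {..<n}" and inj: "inj_on g {..<n}"
    using assms(2) by (auto simp: bij_betw_def)
  show "left_transl_perm G n g k j < n"
    using the_inv_into_into[OF inj * subset_refl] by (simp add: left_transl_perm_def)
  show "g (left_transl_perm G n g k j) = g k \<otimes>\<^bsub>G\<^esub> g j"
    using f_the_inv_into_f[OF inj *] by (simp add: left_transl_perm_def)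
qed

lemma finsum_mat_carrier_index:
  fixes A :: "'b \<Rightarrow> real mat"
  assumes "finite I" "\<And>k. k \<in> I \<Longrightarrow> A k \<in> carrier_mat n n"
  shows "(\<Oplus>\<^bsub>module_mat TYPE(real) n n\<^esub>k\<in>I. A k) \<in> carrier_mat n n \<and>
    (\<forall>i<n. \<forall>j<n. (\<Oplus>\<^bsub>module_mat TYPE(real) n n\<^esub>k\<in>I. A k) $$ (i, j) = (\<Sum>k\<in>I. A k $$ (i, j)))"
proof -
  interpret abelian_group "module_mat TYPE(real) n n"
    by (rule abelian_group_mat)
  show ?thesis
    using assms
  proof (induction I rule: finite_induct)
    case empty
    then show ?case by (simp add: module_mat_simps)
  next
    case (insert k I)
    have "(\<Oplus>\<^bsub>module_mat TYPE(real) n n\<^esub>k\<in>insert k I. A k) =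
        A k + (\<Oplus>\<^bsub>module_mat TYPE(real) n n\<^esub>k\<in>I. A k)"
      using insert by (subst finsum_insert) (auto simp: module_mat_simps)
    moreover have "(\<Oplus>\<^bsub>module_mat TYPE(real) n n\<^esub>k\<in>I. A k) \<in> carrier_mat n n"
      using insert by simp
    ultimately show ?case
      using insert by (auto simp: carrier_matD)
  qed
qed

lemma conv_matrix_carrier: "conv_matrix G n g M X \<in> carrier_mat n n"
  unfolding conv_matrix_def
  by (rule finsum_mat_carrier_index[THEN conjunct1]) (auto simp: perm_matrix_def)

lemma conv_matrix_index:
  assumes "i < n" "j < n"
  shows "conv_matrix G n g M X $$ (i, j) =
    (\<Sum>k<n. \<P>(\<omega> in M. X \<omega> = g k) * (if i = left_transl_perm G n g k j then 1 else 0))"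
  unfolding conv_matrix_def
  using assms by (subst finsum_mat_carrier_index[THEN conjunct2, rule_format])
    (auto simp: perm_matrix_def intro!: sum.cong)

end

theory Submission
  imports Defs
begin

text \<open>The permutation \<open>\<sigma>\<^sub>k\<close> sends \<open>j\<close> to \<open>i\<close> for exactly one \<open>k\<close>, the one with \<open>g k = g i \<otimes> inv (g j)\<close>.
  Hence the \<open>(i, j)\<close> entry of a convolution matrix is the probability that the variable takes the
  value \<open>g i \<otimes> inv (g j)\<close> (lemma \<open>conv_matrix_index_prob\<close>), and no permutations
  are left. What remains is the convolution formula for the law of a product of independent
  variables (lemma \<open>prob_mult_indep\<close>): conditioning on the value of \<open>Y\<close>, written as \<open>c \<otimes> inv (g j)\<close>
  with \<open>c\<close> ranging over the group, forces \<open>X = g i \<otimes> inv c\<close>. With \<open>c = g l\<close> the summands are the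
  products of entries whose sum over \<open>l\<close> is the \<open>(i, j)\<close> entry of the matrix product.\<close>

text \<open>The equation \<open>g i = g k \<otimes> g j\<close> can be solved for \<open>g k\<close>, and the enumeration is a bijection, so the
  sum over \<open>k\<close> collapses to a single term.\<close>

lemma conv_matrix_index_prob:
  fixes G (structure)
  assumes "group G" "bij_betw g {..<n} (carrier G)" "i < n" "j < n"
  shows "conv_matrix G n g M X $$ (i, j) = \<P>(\<omega> in M. X \<omega> = g i \<otimes> inv (g j))"
proof -
  interpret group G by fact
  have g_carrier: "g k \<in> carrier G" if "k < n" for k
    using assms(2) that by (auto simp: bij_betw_def)
  have g_inj: "inj_on g {..<n}"
    using assms(2) by (simp add: bij_betw_def)
  have "g i \<otimes> inv (g j) \<in> g ` {..<n}"
    using assms g_carrier by (simp add: bij_betw_def)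
  then obtain m where m: "m < n" "g m = g i \<otimes> inv (g j)"
    by (metis imageE lessThan_iff)
  have "i = left_transl_perm G n g k j \<longleftrightarrow> k = m" if "k < n" for k
  proof -
    note transl = left_transl_perm[OF assms(1,2) that assms(4)]
    have "i = left_transl_perm G n g k j \<longleftrightarrow> g i = g k \<otimes> g j"
      using inj_on_eq_iff[OF g_inj, of i "left_transl_perm G n g k j"] transl assms(3) by simp
    also have "\<dots> \<longleftrightarrow> g k = g m"
      using inv_solve_right[of "g k" "g i" "g j"] m that assms(3,4) g_carrier by simp
    also have "\<dots> \<longleftrightarrow> k = m"
      using inj_on_eq_iff[OF g_inj, of k m] that m(1) by simp
    finally show ?thesis .
  qed
  then have "conv_matrix G n g M X $$ (i, j) =
      (\<Sum>k<n. if k = m then \<P>(\<omega> in M. X \<omega> = g k) else 0)"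
    unfolding conv_matrix_index[OF assms(3,4)] by (intro sum.cong) auto
  then show ?thesis
    using m by simp
qed

text \<open>The event \<open>X \<otimes> Y = a \<otimes> inv b\<close> splits according to the value of \<open>c = Y \<otimes> b\<close>. Summing over \<open>c\<close>
  instead of over the value \<open>c \<otimes> inv b\<close> of \<open>Y\<close> gives both factors the form of a matrix entry.\<close>

lemma prob_mult_indep:
  fixes G (structure)
  assumes "group G" "finite (carrier G)" "prob_space M"
    and X: "X \<in> measurable M (count_space (carrier G))"
    and Y: "Y \<in> measurable M (count_space (carrier G))"
    and indep: "prob_space.indep_var M (count_space (carrier G)) X (count_space (carrier G)) Y"
    and a: "a \<in> carrier G" and b: "b \<in> carrier G"
  shows "\<P>(\<omega> in M. X \<omega> \<otimes> Y \<omega> = a \<otimes> inv b) =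
    (\<Sum>c\<in>carrier G. \<P>(\<omega> in M. X \<omega> = a \<otimes> inv c) * \<P>(\<omega> in M. Y \<omega> = c \<otimes> inv b))"
proof -
  interpret group G by fact
  interpret prob_space M by fact
  define E where "E c = (X -` {a \<otimes> inv c} \<inter> space M) \<inter> (Y -` {c \<otimes> inv b} \<inter> space M)" for c
  have X_carrier: "X \<omega> \<in> carrier G" and Y_carrier: "Y \<omega> \<in> carrier G" if "\<omega> \<in> space M" for \<omega>
    using measurable_space[OF X that] measurable_space[OF Y that] by auto
  have E_sets: "E c \<in> sets M" if "c \<in> carrier G" for c
    unfolding E_def using a b that
    by (intro sets.Int measurable_sets[OF X] measurable_sets[OF Y]) auto
  have "{\<omega> \<in> space M. X \<omega> \<otimes> Y \<omega> = a \<otimes> inv b} = (\<Union>c\<in>carrier G. E c)"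
  proof (intro equalityI subsetI)
    fix \<omega> assume "\<omega> \<in> {\<omega> \<in> space M. X \<omega> \<otimes> Y \<omega> = a \<otimes> inv b}"
    then have \<omega>: "\<omega> \<in> space M" and prod: "X \<omega> \<otimes> Y \<omega> = a \<otimes> inv b"
      by auto
    note in_carrier = X_carrier[OF \<omega>] Y_carrier[OF \<omega>] a b
    have "X \<omega> \<otimes> (Y \<omega> \<otimes> b) = a"
      using prod in_carrier by (simp add: m_assoc[symmetric]) (simp add: m_assoc)
    then have "X \<omega> = a \<otimes> inv (Y \<omega> \<otimes> b)"
      using in_carrier by (intro inv_solve_right[THEN iffD2]) auto
    moreover have "(Y \<omega> \<otimes> b) \<otimes> inv b = Y \<omega>"
      using in_carrier by (simp add: m_assoc)
    ultimately have "\<omega> \<in> E (Y \<omega> \<otimes> b)"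
      using \<omega> by (simp add: E_def)
    then show "\<omega> \<in> (\<Union>c\<in>carrier G. E c)"
      using in_carrier by blast
  next
    fix \<omega> assume "\<omega> \<in> (\<Union>c\<in>carrier G. E c)"
    then obtain c where c: "c \<in> carrier G" "\<omega> \<in> E c"
      by blast
    have "inv c \<otimes> (c \<otimes> inv b) = inv b"
      using m_assoc[symmetric, of "inv c" c "inv b"] b c(1) by simp
    then have "(a \<otimes> inv c) \<otimes> (c \<otimes> inv b) = a \<otimes> inv b"
      using a b c(1) by (simp add: m_assoc)
    then show "\<omega> \<in> {\<omega> \<in> space M. X \<omega> \<otimes> Y \<omega> = a \<otimes> inv b}"
      using c(2) by (simp add: E_def)
  qed
  then have "\<P>(\<omega> in M. X \<omega> \<otimes> Y \<omega> = a \<otimes> inv b) = prob (\<Union>c\<in>carrier G. E c)"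
    by simp
  also have "\<dots> = (\<Sum>c\<in>carrier G. prob (E c))"
  proof (rule finite_measure_finite_Union)
    \<comment> \<open>The value of \<open>Y\<close> determines \<open>c\<close>.\<close>
    show "disjoint_family_on E (carrier G)"
    proof (unfold disjoint_family_on_def, intro ballI impI, rule ccontr)
      fix c d assume cd: "c \<in> carrier G" "d \<in> carrier G" "c \<noteq> d" and "E c \<inter> E d \<noteq> {}"
      then obtain \<omega> where "\<omega> \<in> E c" "\<omega> \<in> E d"
        by blast
      then have "c \<otimes> inv b = d \<otimes> inv b"
        unfolding E_def by simp
      then show False
        using cd b by simp
    qed
  qed (use assms(2) E_sets in auto)
  also have "\<dots> = (\<Sum>c\<in>carrier G. \<P>(\<omega> in M. X \<omega> = a \<otimes> inv c) * \<P>(\<omega> in M. Y \<omega> = c \<otimes> inv b))"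
  proof (rule sum.cong)
    fix c assume c: "c \<in> carrier G"
    have "prob (E c) = prob ((\<lambda>\<omega>. (X \<omega>, Y \<omega>)) -` ({a \<otimes> inv c} \<times> {c \<otimes> inv b}) \<inter> space M)"
      by (rule arg_cong[where f = prob]) (auto simp: E_def)
    also have "\<dots> = prob (X -` {a \<otimes> inv c} \<inter> space M) * prob (Y -` {c \<otimes> inv b} \<inter> space M)"
      using a b c by (intro indep_varD[OF indep]) auto
    finally show "prob (E c) = \<P>(\<omega> in M. X \<omega> = a \<otimes> inv c) * \<P>(\<omega> in M. Y \<omega> = c \<otimes> inv b)"
      by (simp add: vimage_def Int_def conj_commute)
  qed simp
  finally show ?thesis .
qed

theorem lemma1:
  fixes G :: "('a, 'c) monoid_scheme"
    and n :: nat
    and g :: "nat \<Rightarrow> 'a"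
    and M :: "'w measure"
    and X Y :: "'w \<Rightarrow> 'a"
  assumes "group G"
    and "finite (carrier G)"
    and "bij_betw g {..<n} (carrier G)"
    and "prob_space M"
    and "X \<in> measurable M (count_space (carrier G))"
    and "Y \<in> measurable M (count_space (carrier G))"
    and "prob_space.indep_var M (count_space (carrier G)) X (count_space (carrier G)) Y"
  shows "conv_matrix G n g M (\<lambda>\<omega>. X \<omega> \<otimes>\<^bsub>G\<^esub> Y \<omega>) =
    conv_matrix G n g M X * conv_matrix G n g M Y"
proof -
  let ?A = "conv_matrix G n g M X" and ?B = "conv_matrix G n g M Y"
  note dims = carrier_matD[OF conv_matrix_carrier[of G n g M]]
  show ?thesis
  proof (rule eq_matI)
    fix i j assume "i < dim_row (?A * ?B)" "j < dim_col (?A * ?B)"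
    then have i: "i < n" and j: "j < n"
      by (simp_all add: dims)
    have gi: "g i \<in> carrier G" and gj: "g j \<in> carrier G"
      using assms(3) i j by (auto simp: bij_betw_def)
    have "conv_matrix G n g M (\<lambda>\<omega>. X \<omega> \<otimes>\<^bsub>G\<^esub> Y \<omega>) $$ (i, j) =
        (\<Sum>c\<in>carrier G. \<P>(\<omega> in M. X \<omega> = g i \<otimes>\<^bsub>G\<^esub> inv\<^bsub>G\<^esub> c) * \<P>(\<omega> in M. Y \<omega> = c \<otimes>\<^bsub>G\<^esub> inv\<^bsub>G\<^esub> (g j)))"
      unfolding conv_matrix_index_prob[OF assms(1,3) i j]
      by (rule prob_mult_indep[OF assms(1,2,4-7) gi gj])
    also have "\<dots> = (\<Sum>l<n. \<P>(\<omega> in M. X \<omega> = g i \<otimes>\<^bsub>G\<^esub> inv\<^bsub>G\<^esub> (g l)) *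
        \<P>(\<omega> in M. Y \<omega> = g l \<otimes>\<^bsub>G\<^esub> inv\<^bsub>G\<^esub> (g j)))"
      by (rule sum.reindex_bij_betw[OF assms(3), symmetric])
    also have "\<dots> = (\<Sum>l<n. ?A $$ (i, l) * ?B $$ (l, j))"
      by (intro sum.cong refl) (simp only: lessThan_iff conv_matrix_index_prob[OF assms(1,3)] i j)
    also have "\<dots> = (?A * ?B) $$ (i, j)"
      using i j by (simp add: scalar_prod_def dims atLeast0LessThan)
    finally show "conv_matrix G n g M (\<lambda>\<omega>. X \<omega> \<otimes>\<^bsub>G\<^esub> Y \<omega>) $$ (i, j) = (?A * ?B) $$ (i, j)" .
  qed (simp_all add: dims)
qed

end
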